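(* Given commodities $\{(s_k,t_k,d_k) : k\in\mathcal{K}\}$ and edge capacities $\{u_{ij} : (i,j)\in E\}$ on a directed graph $G(V,E)$, the feasible region of the multicommodity flow constraints (MCF) is not empty if and only if there exists a zero-stable pseudo-flow.
   Context: Setting. $G(V,E)$ is a finite directed graph; $\delta^+(i)=\{j : (i,j)\in E\}$, $\delta^-(i)=\{j : (j,i)\in E\}$, and $\delta_i=|\delta^+(i)|+|\delta^-(i)|$ is the degree of vertex $i$, with $\delta_i\ge 1$ for every $i\in V$. Each edge has a capacity $u_{ij}\in\mathbb{Q}$, $u_{ij}>0$. There is a finite set of commodities $\mathcal{K}=\{1,\dots,K\}$; commodity $k$ has an origin $s_k\in V$, a destination $t_k\in V$ with $s_k\ne t_k$, and a demand $d_k$ (a real number). The multicommodity flow constraints (MCF) on real variables $f_{ij,k}$, $(i,j)\in E$, $k\in\mathcal{K}$, are: $\sum_{k\in\mathcal{K}} f_{ij,k}\le u_{ij}$ for all $(i,j)\in E$; $f_{ij,k}\ge 0$ for all $k\in\mathcal{K}$, $(i,j)\in E$; and, for all $k\in\mathcal{K}$, $i\in V$, $\sum_{j\in\delta^+(i)} f_{ij,k}-\sum_{j\in\delta^-(i)} f_{ji,k}$ equals $d_k$ if $i=s_k$, equals $-d_k$ if $i=t_k$, and equals $0$ otherwise. A pseudo-flow is any family $\boldsymbol{f}=(f_{ij,k})_{(i,j)\in E,\,k\in\mathcal{K}}$ of nonnegative real numbers (capacity and conservation constraints are not required). For a pseudo-flow put $f_{ij}=\sum_{k\in\mathcal{K}}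 f_{ij,k}$ and $$\Delta_{ik}=\sum_{j\in\delta^-(i)} f_{ji,k}-\sum_{j\in\delta^+(i)} f_{ij,k}+\hat\Delta_{ik},$$ where $\hat\Delta_{ik}=d_k$ if $i=s_k$, $\hat\Delta_{ik}=-d_k$ if $i=t_k$, and $\hat\Delta_{ik}=0$ otherwise. The height is $h_{ik}=\Delta_{ik}/\delta_i$. The congestion is $\psi_{ij}=0$ if $f_{ij}\le u_{ij}$ and $\psi_{ij}=f_{ij}-u_{ij}$ if $f_{ij}>u_{ij}$. The potential difference is $\phi_{ij,k}=h_{ik}-h_{jk}-\psi_{ij}$. A pseudo-flow is stable if for all $(i,j)\in E$, $k\in\mathcal{K}$: (i) if $f_{ij,k}>0$ then $\phi_{ij,k}=0$; (ii) if $f_{ij,k}=0$ then $\phi_{ij,k}\le 0$. A stable pseudo-flow is zero-stable if $\psi_{ij}=0$ for all $(i,j)\in E$ and $h_{ik}=0$ for all $i\in V$, $k\in\mathcal{K}$. *)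

theory Defs
  imports Complex_Main "Graph_Theory.Pair_Digraph"
begin

context pair_pre_digraph
begin

definition out_nbrs :: "'a \<Rightarrow> 'a set" where
  "out_nbrs i = {j. (i, j) \<in> parcs G}"

definition in_nbrs :: "'a \<Rightarrow> 'a set" where
  "in_nbrs i = {j. (j, i) \<in> parcs G}"

definition vdeg :: "'a \<Rightarrow> nat" where
  "vdeg i = card (out_nbrs i) + card (in_nbrs i)"

end

(* Self-loops are permitted; a loop counts once in out_nbrs and once in in_nbrs.
   Capacities off the edge set and data of commodities outside {1..K} are irrelevant. *)
locale mcf_network = pair_fin_digraph G
  for G :: "'v pair_pre_digraph" +
  fixes u :: "'v \<Rightarrow> 'v \<Rightarrow> real"
    and K :: nat
    and s t :: "nat \<Rightarrow> 'v"
    and d :: "nat \<Rightarrow> real"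
  assumes vdeg_ge_1: "i \<in> pverts G \<Longrightarrow> vdeg i \<ge> 1"
    and cap_rat: "(i, j) \<in> parcs G \<Longrightarrow> u i j \<in> \<rat>"
    and cap_pos: "(i, j) \<in> parcs G \<Longrightarrow> u i j > 0"
    and src_in_verts: "k \<in> {1..K} \<Longrightarrow> s k \<in> pverts G"
    and dst_in_verts: "k \<in> {1..K} \<Longrightarrow> t k \<in> pverts G"
    and src_neq_dst: "k \<in> {1..K} \<Longrightarrow> s k \<noteq> t k"
begin

(* A flow is a function f, where f i j k is the flow of commodity k on edge (i, j).
   Only its values for (i, j) in parcs G and k in {1..K} are constrained or used. *)

definition net_supply :: "'v \<Rightarrow> nat \<Rightarrow> real" where
  "net_supply i k = (if i = s k then d k else if i = t k then - d k else 0)"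

definition edge_flow :: "('v \<Rightarrow> 'v \<Rightarrow> nat \<Rightarrow> real) \<Rightarrow> 'v \<Rightarrow> 'v \<Rightarrow> real" where
  "edge_flow f i j = (\<Sum>k\<in>{1..K}. f i j k)"

definition feasible_region :: "('v \<Rightarrow> 'v \<Rightarrow> nat \<Rightarrow> real) set" where
  "feasible_region = {f.
     (\<forall>(i, j) \<in> parcs G. edge_flow f i j \<le> u i j) \<and>
     (\<forall>k \<in> {1..K}. \<forall>(i, j) \<in> parcs G. f i j k \<ge> 0) \<and>
     (\<forall>k \<in> {1..K}. \<forall>i \<in> pverts G.
        (\<Sum>j\<in>out_nbrs i. f i j k) - (\<Sum>j\<in>in_nbrs i. f j i k) = net_supply i k)}"

definition pseudo_flow :: "('v \<Rightarrow> 'v \<Rightarrow> nat \<Rightarrow> real) \<Rightarrow> bool" where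
  "pseudo_flow f \<longleftrightarrow> (\<forall>(i, j) \<in> parcs G. \<forall>k \<in> {1..K}. f i j k \<ge> 0)"

definition excess :: "('v \<Rightarrow> 'v \<Rightarrow> nat \<Rightarrow> real) \<Rightarrow> 'v \<Rightarrow> nat \<Rightarrow> real" where
  "excess f i k = (\<Sum>j\<in>in_nbrs i. f j i k) - (\<Sum>j\<in>out_nbrs i. f i j k) + net_supply i k"

definition height :: "('v \<Rightarrow> 'v \<Rightarrow> nat \<Rightarrow> real) \<Rightarrow> 'v \<Rightarrow> nat \<Rightarrow> real" where
  "height f i k = excess f i k / real (vdeg i)"

definition congestion :: "('v \<Rightarrow> 'v \<Rightarrow> nat \<Rightarrow> real) \<Rightarrow> 'v \<Rightarrow> 'v \<Rightarrow> real" where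
  "congestion f i j = (if edge_flow f i j \<le> u i j then 0 else edge_flow f i j - u i j)"

definition potential_diff :: "('v \<Rightarrow> 'v \<Rightarrow> nat \<Rightarrow> real) \<Rightarrow> 'v \<Rightarrow> 'v \<Rightarrow> nat \<Rightarrow> real" where
  "potential_diff f i j k = height f i k - height f j k - congestion f i j"

definition stable :: "('v \<Rightarrow> 'v \<Rightarrow> nat \<Rightarrow> real) \<Rightarrow> bool" where
  "stable f \<longleftrightarrow> pseudo_flow f \<and>
     (\<forall>(i, j) \<in> parcs G. \<forall>k \<in> {1..K}.
        (f i j k > 0 \<longrightarrow> potential_diff f i j k = 0) \<and>
        (f i j k = 0 \<longrightarrow> potential_diff f i j k \<le> 0))"

definition zero_stable :: "('v \<Rightarrow> 'v \<Rightarrow> nat \<Rightarrow> real) \<Rightarrow> bool" where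
  "zero_stable f \<longleftrightarrow> stable f \<and>
     (\<forall>(i, j) \<in> parcs G. congestion f i j = 0) \<and>
     (\<forall>i \<in> pverts G. \<forall>k \<in> {1..K}. height f i k = 0)"

end

end

theory Submission
  imports Defs
begin

text \<open>Feasible flows and zero-stable pseudo-flows are literally the same objects, so no flow has to be
  transformed. Since every degree is positive, a height vanishes exactly when the excess does, and a
  vanishing excess is flow conservation; a vanishing congestion is the capacity constraint. What is
  left of zero-stability, the two conditions on potential differences, then holds by itself: a
  potential difference is a combination of two heights and a congestion, all of which are zero.\<close>

context mcf_network
begin

lemma height_eq_0_iff_conservation:
  assumes "i \<in> pverts G"
  shows "height f i k = 0 \<longleftrightarrow>
    (\<Sum>j\<in>out_nbrs i. f i j k) - (\<Sum>j\<in>in_nbrs i. f j i k) = net_supply i k"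
  using vdeg_ge_1[OF assms] by (auto simp: height_def excess_def)

lemma congestion_eq_0_iff_capacity: "congestion f i j = 0 \<longleftrightarrow> edge_flow f i j \<le> u i j"
  by (auto simp: congestion_def)

lemma stable_if_heights_congestions_0:
  assumes "pseudo_flow f"
    and "\<And>i j. (i, j) \<in> parcs G \<Longrightarrow> congestion f i j = 0"
    and "\<And>i k. i \<in> pverts G \<Longrightarrow> k \<in> {1..K} \<Longrightarrow> height f i k = 0"
  shows "stable f"
proof -
  have "potential_diff f i j k = 0" if "(i, j) \<in> parcs G" "k \<in> {1..K}" for i j k
    using assms(2,3) that in_arcsD1[OF that(1)] in_arcsD2[OF that(1)]
    by (simp add: potential_diff_def)
  with assms(1) show ?thesis
    by (auto simp: stable_def)
qed

theorem feasible_iff_zero_stable: "f \<in> feasible_region \<longleftrightarrow> zero_stable f"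
proof
  assume "f \<in> feasible_region"
  then have "pseudo_flow f"
    and "\<And>i j. (i, j) \<in> parcs G \<Longrightarrow> congestion f i j = 0"
    and "\<And>i k. i \<in> pverts G \<Longrightarrow> k \<in> {1..K} \<Longrightarrow> height f i k = 0"
    by (auto simp: feasible_region_def pseudo_flow_def
        congestion_eq_0_iff_capacity height_eq_0_iff_conservation)
  then show "zero_stable f"
    using stable_if_heights_congestions_0 by (auto simp: zero_stable_def)
next
  assume "zero_stable f"
  then show "f \<in> feasible_region"
    by (auto simp: zero_stable_def stable_def pseudo_flow_def feasible_region_def
        congestion_eq_0_iff_capacity height_eq_0_iff_conservation)
qed

end

theorem theorem1:
  fixes G :: "'v pair_pre_digraph"
    and u :: "'v \<Rightarrow> 'v \<Rightarrow> real"
    and K :: nat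
    and s t :: "nat \<Rightarrow> 'v"
    and d :: "nat \<Rightarrow> real"
  assumes "mcf_network G u K s t"
  shows "mcf_network.feasible_region G u K s t d \<noteq> {} \<longleftrightarrow>
    (\<exists>f. mcf_network.zero_stable G u K s t d f)"
  using mcf_network.feasible_iff_zero_stable[OF assms] by blast

end
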